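(* Let $n\in\mathbb N$ and let $\varPhi=\{\varphi_m\}_{m=1}^\infty\subset\mathcal A$ be a family satisfying the following conditions. (i) For each $m\in\mathbb N$ and each $A>0$ there exists a constant $C_{m,A}>0$ such that $\varphi_m(x)+A\ln(1+\Vert x\Vert)\le\varphi_{m+1}(x)+C_{m,A}$ for all $x\in\mathbb R^n$. (ii) For each $m\in\mathbb N$ there exist constants $\sigma_m>1$ and $\gamma_m>0$ such that $\varphi_m(\sigma_mx)\le\varphi_{m+1}(x)+\gamma_m$ for all $x\in\mathbb R^n$. (iii) For each $m\in\mathbb N$ there exists a constant $K_m>0$ such that $\varphi_m(x+\xi)\le\varphi_{m+1}(x)+K_m$ for all $x\in[0,\infty)^n$, $\xi\in[0,1]^n$. Then each function $f\in\mathcal E(\Psi^* )$ admits a unique extension to an entire function on $\mathbb C^n$, and this extension belongs to $E(\varPhi)$.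
   Context: Notation: $\mathbb N=\{1,2,\dots\}$, $\mathbb Z_+=\{0,1,2,\dots\}$; $\Vert\cdot\Vert$ is the Euclidean norm on $\mathbb R^n$ or $\mathbb C^n$; $H(\mathbb C^n)$ is the space of entire functions on $\mathbb C^n$; $\langle u,v\rangle=u_1v_1+\cdots+u_nv_n$. For $\alpha\in\mathbb Z_+^n$: $|\alpha|=\alpha_1+\cdots+\alpha_n$, $\alpha!=\alpha_1!\cdots\alpha_n!$, $D^\alpha=\partial^{|\alpha|}/\partial x_1^{\alpha_1}\cdots\partial x_n^{\alpha_n}$. $\mathcal A$ is the set of all real-valued $g\in C(\mathbb R^n)$ such that: (1) $g(x)=g(|x_1|,\dots,|x_n|)$ for all $x=(x_1,\dots,x_n)\in\mathbb R^n$; (2) the restriction of $g$ to $[0,\infty)^n$ is nondecreasing in each variable; (3) $\lim_{x\to\infty}g(x)/\Vert x\Vert=+\infty$. The space $E(\varPhi)$: for $\nu\in\mathbb N$, $k\in\mathbb Z_+$ let $$E_k(\varphi_\nu)=\Big\{f\in H(\mathbb C^n):\ p_{\nu,k}(f)=\sup_{z\in\mathbb C^n}\frac{|f(z)|(1+\Vert z\Vert)^k}{e^{\varphi_\nu(|\mathrm{Im}\,z_1|,\dots,|\mathrm{Im}\,z_n|)}}<\infty\Big\},$$ $E(\varphi_\nu)=\bigcap_{k=0}^\infty E_k(\varphi_\nu)$, $E(\varPhi)=\bigcup_{\nu=1}^\infty E(\varphi_\nu)$. The Young–Fenchel conjugate of $g:\mathbb R^n\to[-\infty,+\infty]$ is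 $g^*(x)=\sup_{y\in\mathbb R^n}(\langle x,y\rangle-g(y))$, $x\in\mathbb R^n$. Put $\psi_\nu(x)=\varphi_\nu(e^{x_1},\dots,e^{x_n})$ for $x\in\mathbb R^n$, and $\Psi^*=\{\psi_\nu^*\}_{\nu=1}^\infty$. The space $\mathcal E(\Psi^* )$: for $\nu\in\mathbb N$, $m\in\mathbb Z_+$ let $$\mathcal E_m(\psi_\nu^* )=\Big\{f\in C^\infty(\mathbb R^n):\ \sup_{x\in\mathbb R^n,\ \alpha\in\mathbb Z_+^n}\frac{(1+\Vert x\Vert)^m|(D^\alpha f)(x)|}{\alpha!\,e^{-\psi_\nu^*(\alpha)}}<\infty\Big\},$$ $\mathcal E(\psi_\nu^* )=\bigcap_{m=0}^\infty\mathcal E_m(\psi_\nu^* )$, $\mathcal E(\Psi^* )=\bigcup_{\nu=1}^\infty\mathcal E(\psi_\nu^* )$. Functions are complex-valued. *)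

theory Defs
  imports "HOL-Analysis.Analysis"
begin

definition entire :: "(complex ^ 'n \<Rightarrow> complex) \<Rightarrow> bool" where
  "entire F \<longleftrightarrow>
     (\<forall>z. \<exists>L. (F has_derivative L) (at z) \<and> (\<forall>c v. L (c *s v) = c * L v))"

definition real_point :: "real ^ 'n \<Rightarrow> complex ^ 'n" where
  "real_point x = (\<chi> i. complex_of_real (x $ i))"

definition class_A :: "(real ^ 'n \<Rightarrow> real) set" where
  "class_A = {g. continuous_on UNIV g
     \<and> (\<forall>x. g x = g (\<chi> i. \<bar>x $ i\<bar>))
     \<and> (\<forall>x i t. (\<forall>j. 0 \<le> x $ j) \<and> x $ i \<le> t \<longrightarrow> g x \<le> g (\<chi> j. if j = i then t else x $ j))
     \<and> filterlim (\<lambda>x. g x / norm x) at_top at_infinity}"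

text \<open>The seminorms are suprema in the extended reals, so that finiteness is a genuine condition.\<close>

definition p_norm :: "(real ^ 'n \<Rightarrow> real) \<Rightarrow> nat \<Rightarrow> (complex ^ 'n \<Rightarrow> complex) \<Rightarrow> ereal" where
  "p_norm \<phi> k f =
     (SUP z. ereal (norm (f z) * (1 + norm z) ^ k / exp (\<phi> (\<chi> i. \<bar>Im (z $ i)\<bar>))))"

definition E_k :: "(real ^ 'n \<Rightarrow> real) \<Rightarrow> nat \<Rightarrow> (complex ^ 'n \<Rightarrow> complex) set" where
  "E_k \<phi> k = {f. entire f \<and> p_norm \<phi> k f < \<infinity>}"

definition E_weight :: "(real ^ 'n \<Rightarrow> real) \<Rightarrow> (complex ^ 'n \<Rightarrow> complex) set" where
  "E_weight \<phi> = (\<Inter>k. E_k \<phi> k)"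

text \<open>Families are sequences indexed from 1; the value at index 0 is irrelevant.\<close>

definition E_family :: "(nat \<Rightarrow> real ^ 'n \<Rightarrow> real) \<Rightarrow> (complex ^ 'n \<Rightarrow> complex) set" where
  "E_family \<Phi> = (\<Union>\<nu>\<in>{1..}. E_weight (\<Phi> \<nu>))"

definition young_fenchel :: "(real ^ 'n \<Rightarrow> ereal) \<Rightarrow> real ^ 'n \<Rightarrow> ereal" where
  "young_fenchel g x = (SUP y. ereal (x \<bullet> y) - g y)"

definition psi :: "(real ^ 'n \<Rightarrow> real) \<Rightarrow> real ^ 'n \<Rightarrow> real" where
  "psi \<phi> x = \<phi> (\<chi> i. exp (x $ i))"

definition psi_star :: "(real ^ 'n \<Rightarrow> real) \<Rightarrow> real ^ 'n \<Rightarrow> ereal" where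
  "psi_star \<phi> = young_fenchel (\<lambda>x. ereal (psi \<phi> x))"

definition partial_deriv :: "'n \<Rightarrow> (real ^ 'n \<Rightarrow> complex) \<Rightarrow> real ^ 'n \<Rightarrow> complex" where
  "partial_deriv i f x = vector_derivative (\<lambda>t. f (x + t *\<^sub>R axis i 1)) (at 0)"

primrec C_k :: "nat \<Rightarrow> (real ^ 'n \<Rightarrow> complex) \<Rightarrow> bool" where
  "C_k 0 f \<longleftrightarrow> continuous_on UNIV f"
| "C_k (Suc k) f \<longleftrightarrow> continuous_on UNIV f
     \<and> (\<forall>i x. (\<lambda>t. f (x + t *\<^sub>R axis i 1)) differentiable (at 0))
     \<and> (\<forall>i. C_k k (partial_deriv i f))"

definition C_infinity :: "(real ^ 'n \<Rightarrow> complex) \<Rightarrow> bool" where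
  "C_infinity f \<longleftrightarrow> (\<forall>k. C_k k f)"

text \<open>The index type \<open>'n\<close> carries no order, so the iterated partial derivatives are taken along an
  arbitrary fixed enumeration of the coordinates. For smooth functions, the only ones to which
  \<open>D_multi\<close> is applied, mixed partial derivatives commute and the enumeration does not matter.\<close>

definition coords :: "'n::finite list" where
  "coords = (SOME is. distinct is \<and> set is = UNIV)"

lemma coords: "distinct (coords :: 'n::finite list)" "set (coords :: 'n list) = UNIV"
proof -
  have "\<exists>is :: 'n list. distinct is \<and> set is = UNIV"
    using finite_distinct_list[of "UNIV :: 'n set"] by auto
  then have "distinct (coords :: 'n list) \<and> set (coords :: 'n list) = UNIV"
    unfolding coords_def by (rule someI_ex)
  then show "distinct (coords :: 'n list)" "set (coords :: 'n list) = UNIV" by auto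
qed

definition D_multi :: "nat ^ 'n \<Rightarrow> (real ^ 'n \<Rightarrow> complex) \<Rightarrow> real ^ 'n \<Rightarrow> complex" where
  "D_multi \<alpha> f = foldr (\<lambda>i g. (partial_deriv i ^^ (\<alpha> $ i)) g) coords f"

definition multi_fact :: "nat ^ 'n \<Rightarrow> real" where
  "multi_fact \<alpha> = (\<Prod>i\<in>UNIV. fact (\<alpha> $ i))"

definition multi_real :: "nat ^ 'n \<Rightarrow> real ^ 'n" where
  "multi_real \<alpha> = (\<chi> i. real (\<alpha> $ i))"

text \<open>Here \<open>h\<close> is a conjugate \<open>psi_star \<phi>\<close> with \<open>\<phi> \<in> class_A\<close>; it is finite at multi-indices
  by lemma \<open>psi_star_finite\<close> below, so the conversion by \<open>real_of_ereal\<close> is harmless.\<close>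

definition q_norm :: "(real ^ 'n \<Rightarrow> ereal) \<Rightarrow> nat \<Rightarrow> (real ^ 'n \<Rightarrow> complex) \<Rightarrow> ereal" where
  "q_norm h m f =
     (SUP (x, \<alpha>). ereal ((1 + norm x) ^ m * norm (D_multi \<alpha> f x) /
        (multi_fact \<alpha> * exp (- real_of_ereal (h (multi_real \<alpha>))))))"

definition smooth_E_m :: "(real ^ 'n \<Rightarrow> ereal) \<Rightarrow> nat \<Rightarrow> (real ^ 'n \<Rightarrow> complex) set" where
  "smooth_E_m h m = {f. C_infinity f \<and> q_norm h m f < \<infinity>}"

definition smooth_E_weight :: "(real ^ 'n \<Rightarrow> ereal) \<Rightarrow> (real ^ 'n \<Rightarrow> complex) set" where
  "smooth_E_weight h = (\<Inter>m. smooth_E_m h m)"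

definition smooth_E_family :: "(nat \<Rightarrow> real ^ 'n \<Rightarrow> ereal) \<Rightarrow> (real ^ 'n \<Rightarrow> complex) set" where
  "smooth_E_family H = (\<Union>\<nu>\<in>{1..}. smooth_E_weight (H \<nu>))"

lemma class_A_superlinear:
  fixes g :: "real ^ 'n \<Rightarrow> real"
  assumes "g \<in> class_A"
  shows "\<exists>C. \<forall>x. M * norm x \<le> g x + C"
proof -
  have cont: "continuous_on UNIV g" and lim: "filterlim (\<lambda>x. g x / norm x) at_top at_infinity"
    using assms by (auto simp: class_A_def)
  obtain R where R: "\<And>x. norm x \<ge> R \<Longrightarrow> M \<le> g x / norm x"
    using lim unfolding filterlim_at_top eventually_at_infinity by blast
  have "compact ((\<lambda>x. M * norm x - g x) ` cball 0 (max R 1))"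
    by (intro compact_continuous_image compact_cball continuous_intros continuous_on_subset[OF cont]) auto
  then have "bounded ((\<lambda>x. M * norm x - g x) ` cball 0 (max R 1))"
    by (rule compact_imp_bounded)
  then obtain B where B: "\<And>x. norm x \<le> max R 1 \<Longrightarrow> \<bar>M * norm x - g x\<bar> \<le> B"
    unfolding bounded_iff by (force simp: Ball_def)
  have "M * norm x \<le> g x + \<bar>B\<bar>" for x
  proof (cases "norm x \<le> max R 1")
    case True
    then show ?thesis using B[of x] by linarith
  next
    case False
    then have "R \<le> norm x" "0 < norm x" by linarith+
    then have "M * norm x \<le> g x" using R[of x] by (simp add: pos_le_divide_eq)
    then show ?thesis by linarith
  qed
  then show ?thesis by blast
qed

lemma psi_star_finite:
  fixes \<phi> :: "real ^ 'n \<Rightarrow> real"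
  assumes "\<phi> \<in> class_A" and nonneg: "\<And>i. 0 \<le> x $ i"
  shows "\<bar>psi_star \<phi> x\<bar> \<noteq> \<infinity>"
proof -
  define M where "M = (\<Sum>i\<in>UNIV. x $ i)"
  obtain C where C: "\<And>u. M * norm u \<le> \<phi> u + C"
    using class_A_superlinear[OF assms(1)] by blast
  have bound: "x \<bullet> y - psi \<phi> y \<le> C" for y
  proof -
    define u :: "real ^ 'n" where "u = (\<chi> i. exp (y $ i))"
    have "x \<bullet> y = (\<Sum>i\<in>UNIV. x $ i * y $ i)" by (simp add: inner_vec_def)
    also have "\<dots> \<le> (\<Sum>i\<in>UNIV. x $ i * norm u)"
    proof (intro sum_mono mult_left_mono nonneg)
      fix i
      have "y $ i \<le> exp (y $ i)" using exp_ge_add_one_self[of "y $ i"] by linarith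
      also have "\<dots> \<le> norm u" using component_le_norm_cart[of u i] by (simp add: u_def)
      finally show "y $ i \<le> norm u" .
    qed
    also have "\<dots> = M * norm u" by (simp add: M_def sum_distrib_right)
    also have "\<dots> \<le> psi \<phi> y + C" using C[of u] by (simp add: psi_def u_def)
    finally show ?thesis by simp
  qed
  have "psi_star \<phi> x \<le> ereal C"
    unfolding psi_star_def young_fenchel_def using bound by (intro SUP_least) simp
  moreover have "ereal (x \<bullet> 0 - psi \<phi> 0) \<le> psi_star \<phi> x"
    unfolding psi_star_def young_fenchel_def by (rule SUP_upper2[of 0]) auto
  ultimately show ?thesis by (cases "psi_star \<phi> x") auto
qed

end

theory Submission
  imports Defs "HOL-Complex_Analysis.Conformal_Mappings"
begin

text \<open>The extension is given by the Taylor series in the imaginary directions,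
  \<open>F (x + iy) = (\<Sum>\<alpha>. D\<^sup>\<alpha> f(x) / \<alpha>! (iy)\<^sup>\<alpha>)\<close>, grouped by the degree of \<open>\<alpha>\<close>. The decay of
  \<open>exp (- \<psi>\<^sub>\<nu>\<^sup>*(\<alpha>))\<close> is faster than geometric, so the series may be differentiated termwise in
  \<open>x\<close> and \<open>y\<close>, and shifting the index by \<open>e\<^sub>j\<close> shows \<open>\<partial>F/\<partial>y\<^sub>j = i \<partial>F/\<partial>x\<^sub>j\<close>. No Taylor formula with
  remainder is needed, since \<open>F = f\<close> on the real points by construction.

  For the growth bound, \<open>\<psi>\<^sub>\<nu>\<^sup>*(\<alpha>) \<ge> \<langle>\<alpha>, ln r\<rangle> - \<phi>\<^sub>\<nu>(r)\<close> is used at \<open>r\<^sub>j = \<sigma>\<^sub>\<nu>(\<bar>y\<^sub>j\<bar> + 1)\<close>: the factor \<open>\<sigma>\<^sub>\<nu>\<close>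
  makes the series converge geometrically, the summand 1 avoids logarithms of zero, and conditions
  (ii), (iii), (i), in this order, return to the weight \<open>\<phi>\<^bsub>\<nu>+3\<^esub>(y)\<close>.\<close>

subsection \<open>Partial derivatives of smooth functions\<close>

text \<open>Mean value inequality for \<open>g t - t *\<^sub>R c\<close>, whose derivative is
  \<open>g' t - c\<close>. The interval is symmetric because \<open>s\<close> will be a component of
  an arbitrary increment and may be negative.\<close>

lemma norm_increment_minus_linear_le:
  fixes g :: "real \<Rightarrow> 'a::real_normed_vector"
  assumes "\<And>t. \<bar>t\<bar> \<le> \<bar>s\<bar> \<Longrightarrow> (g has_vector_derivative g' t) (at t)"
    and "\<And>t. \<bar>t\<bar> \<le> \<bar>s\<bar> \<Longrightarrow> norm (g' t - c) \<le> e"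
  shows "norm (g s - g 0 - s *\<^sub>R c) \<le> e * \<bar>s\<bar>"
proof -
  have "norm ((\<lambda>t. g t - t *\<^sub>R c) s - (\<lambda>t. g t - t *\<^sub>R c) 0) \<le> e * norm (s - 0)"
  proof (rule differentiable_bound[where S = "{-\<bar>s\<bar>..\<bar>s\<bar>}" and f' = "\<lambda>t h. h *\<^sub>R (g' t - c)"])
    fix t assume "t \<in> {-\<bar>s\<bar>..\<bar>s\<bar>}"
    then have t: "\<bar>t\<bar> \<le> \<bar>s\<bar>" by auto
    have "((\<lambda>t. t *\<^sub>R c) has_vector_derivative c) (at t)"
      unfolding has_vector_derivative_def by (intro has_derivative_scaleR_left has_derivative_ident)
    then have "((\<lambda>t. g t - t *\<^sub>R c) has_vector_derivative g' t - c) (at t)"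
      by (intro has_vector_derivative_diff assms(1) t)
    then show "((\<lambda>t. g t - t *\<^sub>R c) has_derivative (\<lambda>h. h *\<^sub>R (g' t - c))) (at t within {-\<bar>s\<bar>..\<bar>s\<bar>})"
      by (simp add: has_vector_derivative_def has_derivative_at_withinI)
    have "norm (h *\<^sub>R (g' t - c)) \<le> e * norm h" for h
      using mult_left_mono[OF assms(2)[OF t], of "\<bar>h\<bar>"] by (simp add: mult.commute)
    then show "onorm (\<lambda>h. h *\<^sub>R (g' t - c)) \<le> e" by (rule onorm_le)
  qed auto
  then show ?thesis by (simp add: algebra_simps)
qed

lemma C_infinity_continuous: "C_infinity f \<Longrightarrow> continuous_on UNIV f"
  unfolding C_infinity_def by (metis C_k.simps(1))

lemma C_infinity_partial_deriv: "C_infinity f \<Longrightarrow> C_infinity (partial_deriv i f)"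
  unfolding C_infinity_def by (metis C_k.simps(2))

lemma C_infinity_partial_deriv_funpow: "C_infinity f \<Longrightarrow> C_infinity ((partial_deriv i ^^ k) f)"
  by (induction k) (auto intro: C_infinity_partial_deriv)

text \<open>\<open>C_k\<close> speaks only of slices at parameter 0; the slice is based anew at
  \<open>x + s *\<^sub>R axis i 1\<close> and its parameter translated.\<close>

lemma has_vector_derivative_partial_deriv:
  assumes "C_infinity f"
  shows "((\<lambda>t. f (x + t *\<^sub>R axis i 1)) has_vector_derivative partial_deriv i f (x + s *\<^sub>R axis i 1)) (at s)"
proof -
  define y where "y = x + s *\<^sub>R axis i 1"
  have "(\<lambda>t. f (y + t *\<^sub>R axis i 1)) differentiable (at 0)"
    using assms unfolding C_infinity_def by (metis C_k.simps(2))
  then have "((\<lambda>t. f (y + t *\<^sub>R axis i 1)) has_vector_derivative partial_deriv i f y) (at 0)"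
    unfolding partial_deriv_def vector_derivative_works[symmetric] by simp
  moreover have "((\<lambda>t. t - s) has_vector_derivative 1) (at s)"
    by (auto intro!: derivative_eq_intros)
  ultimately have "((\<lambda>t. f (y + t *\<^sub>R axis i 1)) \<circ> (\<lambda>t. t - s) has_vector_derivative 1 *\<^sub>R partial_deriv i f y) (at s)"
    by (intro vector_diff_chain_at) auto
  then show ?thesis by (simp add: o_def y_def algebra_simps)
qed

text \<open>Continuous partial derivatives give total differentiability: the increment is carried
  out one coordinate at a time, by induction on the set of coordinates already moved.\<close>

lemma has_derivative_partial_deriv:
  fixes f :: "real ^ 'n \<Rightarrow> complex"
  assumes smooth: "C_infinity f"
  shows "(f has_derivative (\<lambda>h. \<Sum>j\<in>UNIV. (h $ j) *\<^sub>R partial_deriv j f x)) (at x)"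
proof -
  \<comment> \<open>\<open>x + res S h\<close> is the intermediate point at which exactly the
    coordinates in \<open>S\<close> have been moved.\<close>
  define res :: "'n set \<Rightarrow> real ^ 'n \<Rightarrow> real ^ 'n" where "res = (\<lambda>S h. \<chi> i. if i \<in> S then h $ i else 0)"
  have norm_res: "norm (res S h) \<le> norm h" for S h
    by (intro norm_le_componentwise_cart) (auto simp: res_def)
  have increment: "\<exists>d>0. \<forall>h. norm h < d \<longrightarrow>
      norm (f (x + res S h) - f x - (\<Sum>j\<in>S. (h $ j) *\<^sub>R partial_deriv j f x)) \<le> e * norm h"
    if "finite S" "e > 0" for S e
    using that
  proof (induction S arbitrary: e rule: finite_induct)
    case empty
    have "res {} h = 0" for h by (simp add: res_def vec_eq_iff)
    then show ?case using empty by (auto intro!: exI[of _ 1])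
  next
    case (insert i S)
    obtain d1 where d1: "d1 > 0" "\<And>h. norm h < d1 \<Longrightarrow>
      norm (f (x + res S h) - f x - (\<Sum>j\<in>S. (h $ j) *\<^sub>R partial_deriv j f x)) \<le> e / 2 * norm h"
      using insert.IH[of "e / 2"] insert.prems by auto
    have "isCont (partial_deriv i f) x"
      using C_infinity_continuous[OF C_infinity_partial_deriv[OF smooth]]
      by (simp add: continuous_on_eq_continuous_at)
    then obtain d2 where d2: "d2 > 0" "\<And>y. dist y x < d2 \<Longrightarrow> dist (partial_deriv i f y) (partial_deriv i f x) < e / 2"
      unfolding continuous_at_eps_delta using insert.prems by (metis half_gt_zero)
    \<comment> \<open>Half of the tolerance goes to the old coordinates and half to the new one. The
      radius \<open>d2 / 2\<close> is forced by intermediate points, which may lie up to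
      \<open>2 * norm h\<close> away from \<open>x\<close>.\<close>
    show ?case
    proof (intro exI[of _ "min d1 (d2 / 2)"] conjI allI impI)
      fix h :: "real ^ 'n" assume h: "norm h < min d1 (d2 / 2)"
      have split: "res (insert i S) h = res S h + (h $ i) *\<^sub>R axis i 1"
        using insert.hyps by (auto simp: res_def vec_eq_iff axis_def)
      have "norm (f (x + res S h + (h $ i) *\<^sub>R axis i 1) - f (x + res S h + 0 *\<^sub>R axis i 1)
              - (h $ i) *\<^sub>R partial_deriv i f x) \<le> e / 2 * \<bar>h $ i\<bar>"
      proof (rule norm_increment_minus_linear_le[OF has_vector_derivative_partial_deriv[OF smooth]])
        fix t assume t: "\<bar>t\<bar> \<le> \<bar>h $ i\<bar>"
        have "norm (res S h + t *\<^sub>R axis i 1) \<le> norm (res S h) + \<bar>t\<bar>"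
          using norm_triangle_ineq[of "res S h" "t *\<^sub>R axis i 1"] by simp
        also have "\<dots> \<le> norm h + norm h"
          using norm_res[of S h] t component_le_norm_cart[of h i] by linarith
        finally have "dist (x + res S h + t *\<^sub>R axis i 1) x < d2"
          using h by (simp add: dist_norm add.assoc)
        then show "norm (partial_deriv i f (x + res S h + t *\<^sub>R axis i 1) - partial_deriv i f x) \<le> e / 2"
          using d2(2) by (fastforce simp: dist_norm intro: less_imp_le)
      qed
      also have "\<dots> \<le> e / 2 * norm h"
        using insert.prems component_le_norm_cart[of h i] by (intro mult_left_mono) auto
      finally have last: "norm (f (x + res (insert i S) h) - f (x + res S h)
              - (h $ i) *\<^sub>R partial_deriv i f x) \<le> e / 2 * norm h"
        by (simp add: split add.assoc)
      have "f (x + res (insert i S) h) - f x - (\<Sum>j\<in>insert i S. (h $ j) *\<^sub>R partial_deriv j f x)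
        = (f (x + res (insert i S) h) - f (x + res S h) - (h $ i) *\<^sub>R partial_deriv i f x)
          + (f (x + res S h) - f x - (\<Sum>j\<in>S. (h $ j) *\<^sub>R partial_deriv j f x))"
        using insert.hyps by simp
      then show "norm (f (x + res (insert i S) h) - f x - (\<Sum>j\<in>insert i S. (h $ j) *\<^sub>R partial_deriv j f x))
        \<le> e * norm h"
        using norm_triangle_le[OF add_mono[OF last d1(2)[of h]]] h by (auto simp: field_simps)
    qed (use d1 d2 in auto)
  qed
  have "res UNIV h = h" for h by (simp add: res_def vec_eq_iff)
  then have near: "\<exists>d>0. \<forall>h. norm h < d \<longrightarrow>
      norm (f (x + h) - f x - (\<Sum>j\<in>UNIV. (h $ j) *\<^sub>R partial_deriv j f x)) \<le> e * norm h" if "e > 0" for e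
    using increment[of UNIV e] that by auto
  have "bounded_linear (\<lambda>h. \<Sum>j\<in>UNIV. (h $ j) *\<^sub>R partial_deriv j f x)"
    by (intro bounded_linear_sum bounded_linear_scaleR_const bounded_linear_vec_nth)
  then show ?thesis
    unfolding has_derivative_at_alt
  proof (intro conjI allI impI)
    fix e :: real assume "e > 0"
    then obtain d where d: "d > 0" "\<And>h. norm h < d \<Longrightarrow>
      norm (f (x + h) - f x - (\<Sum>j\<in>UNIV. (h $ j) *\<^sub>R partial_deriv j f x)) \<le> e * norm h"
      using near by blast
    have "norm (f y - f x - (\<Sum>j\<in>UNIV. ((y - x) $ j) *\<^sub>R partial_deriv j f x)) \<le> e * norm (y - x)"
      if "norm (y - x) < d" for y
      using d(2)[OF that] by simp
    then show "\<exists>d>0. \<forall>y. norm (y - x) < d \<longrightarrow>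
      norm (f y - f x - (\<Sum>j\<in>UNIV. ((y - x) $ j) *\<^sub>R partial_deriv j f x)) \<le> e * norm (y - x)"
      using d(1) by (intro exI[of _ d] conjI allI impI)
  qed
qed

text \<open>Both mixed derivatives approximate the second difference quotient of \<open>f\<close> over a small
  rectangle with sides parallel to \<open>e\<^sub>i\<close> and \<open>e\<^sub>j\<close>.\<close>

lemma partial_deriv_commute:
  fixes f :: "real ^ 'n \<Rightarrow> complex"
  assumes smooth: "C_infinity f"
  shows "partial_deriv i (partial_deriv j f) = partial_deriv j (partial_deriv i f)"
proof
  fix x
  define \<Delta> where "\<Delta> = (\<lambda>i j s t. f (x + s *\<^sub>R axis i 1 + t *\<^sub>R axis j 1) - f (x + s *\<^sub>R axis i 1)
      - f (x + t *\<^sub>R axis j 1) + f x)"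
  have quotient: "\<exists>d>0. \<forall>s. 0 < s \<and> s < d \<longrightarrow>
      norm (\<Delta> i j s s - s *\<^sub>R s *\<^sub>R partial_deriv j (partial_deriv i f) x) \<le> e * s * s"
    if "e > 0" for i j e
  proof -
    define Q where "Q = partial_deriv j (partial_deriv i f)"
    have "isCont Q x"
      using C_infinity_continuous[OF C_infinity_partial_deriv[OF C_infinity_partial_deriv[OF smooth]]]
      by (simp add: continuous_on_eq_continuous_at Q_def)
    then obtain d where d: "d > 0" "\<And>y. dist y x < d \<Longrightarrow> dist (Q y) (Q x) < e"
      unfolding continuous_at_eps_delta using \<open>e > 0\<close> by metis
    have "norm (\<Delta> i j s s - s *\<^sub>R s *\<^sub>R Q x) \<le> e * s * s" if s: "0 < s" "s < d / 2" for s
    proof -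
      \<comment> \<open>The second difference is the increment of \<open>g\<close> along
        \<open>axis i 1\<close>, and \<open>g'\<close> is itself an increment along
        \<open>axis j 1\<close>. The mean value inequality is applied once in each
        direction.\<close>
      define g where "g = (\<lambda>u. f (x + s *\<^sub>R axis j 1 + u *\<^sub>R axis i 1) - f (x + u *\<^sub>R axis i 1))"
      define g' where "g' = (\<lambda>u. partial_deriv i f (x + s *\<^sub>R axis j 1 + u *\<^sub>R axis i 1)
          - partial_deriv i f (x + u *\<^sub>R axis i 1))"
      have "norm (g s - g 0 - s *\<^sub>R (s *\<^sub>R Q x)) \<le> (e * s) * \<bar>s\<bar>"
      proof (rule norm_increment_minus_linear_le)
        show "(g has_vector_derivative g' u) (at u)" for u
          unfolding g_def g'_def
          by (intro has_vector_derivative_diff has_vector_derivative_partial_deriv smooth)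
        fix u assume u: "\<bar>u\<bar> \<le> \<bar>s\<bar>"
        have "norm (partial_deriv i f (x + u *\<^sub>R axis i 1 + s *\<^sub>R axis j 1)
           - partial_deriv i f (x + u *\<^sub>R axis i 1 + 0 *\<^sub>R axis j 1) - s *\<^sub>R Q x) \<le> e * \<bar>s\<bar>"
        proof (rule norm_increment_minus_linear_le[OF
              has_vector_derivative_partial_deriv[OF C_infinity_partial_deriv[OF smooth]]])
          fix t assume t: "\<bar>t\<bar> \<le> \<bar>s\<bar>"
          have "norm (u *\<^sub>R axis i 1 + t *\<^sub>R axis j (1::real)) \<le> \<bar>u\<bar> + \<bar>t\<bar>"
            using norm_triangle_ineq[of "u *\<^sub>R axis i (1::real)" "t *\<^sub>R axis j 1"] by simp
          then have "dist (x + u *\<^sub>R axis i 1 + t *\<^sub>R axis j 1) x < d"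
            using t u s by (simp add: dist_norm add.assoc)
          then show "norm (partial_deriv j (partial_deriv i f) (x + u *\<^sub>R axis i 1 + t *\<^sub>R axis j 1) - Q x) \<le> e"
            using d(2) by (fastforce simp: dist_norm Q_def intro: less_imp_le)
        qed
        then show "norm (g' u - s *\<^sub>R Q x) \<le> e * s"
          using s by (simp add: g'_def algebra_simps)
      qed
      moreover have "g s - g 0 = \<Delta> i j s s" by (simp add: g_def \<Delta>_def algebra_simps)
      ultimately show ?thesis using s by simp
    qed
    then show ?thesis using d(1) unfolding Q_def by (intro exI[of _ "d / 2"]) auto
  qed
  \<comment> \<open>The second difference does not see the order of the directions, so one small
    \<open>s\<close> compares both mixed derivatives with the same number.\<close>
  have sym: "\<Delta> i j s s = \<Delta> j i s s" for s by (simp add: \<Delta>_def algebra_simps)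
  have "norm (partial_deriv i (partial_deriv j f) x - partial_deriv j (partial_deriv i f) x) \<le> 0 + e"
    if e: "e > 0" for e
  proof -
    obtain d1 where d1: "d1 > 0" "\<And>s. 0 < s \<Longrightarrow> s < d1 \<Longrightarrow>
      norm (\<Delta> i j s s - s *\<^sub>R s *\<^sub>R partial_deriv j (partial_deriv i f) x) \<le> e / 2 * s * s"
      using quotient[of "e / 2" i j] e by auto
    obtain d2 where d2: "d2 > 0" "\<And>s. 0 < s \<Longrightarrow> s < d2 \<Longrightarrow>
      norm (\<Delta> j i s s - s *\<^sub>R s *\<^sub>R partial_deriv i (partial_deriv j f) x) \<le> e / 2 * s * s"
      using quotient[of "e / 2" j i] e by auto
    define s where "s = min d1 d2 / 2"
    have s: "0 < s" "s < d1" "s < d2" using d1(1) d2(1) by (auto simp: s_def)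
    let ?P = "partial_deriv i (partial_deriv j f) x" and ?Q = "partial_deriv j (partial_deriv i f) x"
    have "(s * s) *\<^sub>R (?P - ?Q) = (\<Delta> i j s s - s *\<^sub>R s *\<^sub>R ?Q) - (\<Delta> j i s s - s *\<^sub>R s *\<^sub>R ?P)"
      by (simp add: sym[of s] algebra_simps)
    then have "norm ((s * s) *\<^sub>R (?P - ?Q)) \<le> e / 2 * s * s + e / 2 * s * s"
      using norm_triangle_le_diff[OF add_mono[OF d1(2)[OF s(1,2)] d2(2)[OF s(1,3)]]] by simp
    also have "\<dots> = (s * s) * e" by simp
    finally have "(s * s) * norm (?P - ?Q) \<le> (s * s) * e" unfolding norm_scaleR by simp
    then show ?thesis using s by simp
  qed
  then show "partial_deriv i (partial_deriv j f) x = partial_deriv j (partial_deriv i f) x"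
    using field_le_epsilon[of "norm (partial_deriv i (partial_deriv j f) x - partial_deriv j (partial_deriv i f) x)" 0]
    by auto
qed

lemma partial_deriv_funpow_commute:
  assumes "C_infinity f"
  shows "(partial_deriv i ^^ k) (partial_deriv j f) = partial_deriv j ((partial_deriv i ^^ k) f)"
  by (induction k) (simp_all add: partial_deriv_commute C_infinity_partial_deriv_funpow assms)

lemma C_infinity_foldr_partial_deriv:
  assumes "C_infinity f"
  shows "C_infinity (foldr (\<lambda>i g. (partial_deriv i ^^ (\<alpha> $ i)) g) is f)"
  by (induction "is") (auto simp: assms intro: C_infinity_partial_deriv_funpow)

lemma C_infinity_D_multi: "C_infinity f \<Longrightarrow> C_infinity (D_multi \<alpha> f)"
  unfolding D_multi_def by (rule C_infinity_foldr_partial_deriv)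

text \<open>Raising the exponent of \<open>j\<close> inserts one more \<open>partial_deriv j\<close>
  at the place of \<open>j\<close> in the enumeration, and commutation moves it to the front. The
  induction runs over arbitrary distinct lists, hence the case where \<open>j\<close> does not
  occur.\<close>

lemma partial_deriv_D_multi:
  assumes "C_infinity f"
  shows "partial_deriv j (D_multi \<alpha> f) = D_multi (\<alpha> + axis j 1) f"
proof -
  let ?D = "\<lambda>\<alpha> is. foldr (\<lambda>i g. (partial_deriv i ^^ (\<alpha> $ i)) g) is f"
  have "?D (\<alpha> + axis j 1) is = (if j \<in> set is then partial_deriv j (?D \<alpha> is) else ?D \<alpha> is)"
    if "distinct is" for "is"
    using that
    by (induction "is")
      (auto simp: axis_def partial_deriv_funpow_commute C_infinity_foldr_partial_deriv assms)
  from this[of coords] show ?thesis by (simp add: D_multi_def coords)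
qed

subsection \<open>Multi-indices of a given degree\<close>

definition multi_indices :: "nat \<Rightarrow> (nat ^ 'n) set" where
  "multi_indices k = {\<alpha>. (\<Sum>i\<in>UNIV. \<alpha> $ i) = k}"

text \<open>A component cannot exceed the degree. This crude box yields finiteness and a count
  polynomial in \<open>k\<close>, which geometric decay will absorb.\<close>

lemma multi_indices_subset: "multi_indices k \<subseteq> vec_lambda ` (UNIV \<rightarrow>\<^sub>E {..k})"
proof
  fix \<alpha> :: "nat ^ 'n" assume "\<alpha> \<in> multi_indices k"
  then have "\<alpha> $ i \<le> k" for i
    unfolding multi_indices_def using member_le_sum[of i UNIV "\<lambda>i. \<alpha> $ i"] by auto
  then show "\<alpha> \<in> vec_lambda ` (UNIV \<rightarrow>\<^sub>E {..k})"
    by (intro image_eqI[of _ _ "vec_nth \<alpha>"]) auto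
qed

lemma finite_multi_indices: "finite (multi_indices k)"
  by (rule finite_subset[OF multi_indices_subset]) (intro finite_imageI finite_PiE, auto)

lemma card_multi_indices_le: "card (multi_indices k :: (nat ^ 'n) set) \<le> (k + 1) ^ CARD('n)"
proof -
  have "card (multi_indices k :: (nat ^ 'n) set) \<le> card (vec_lambda ` ((UNIV :: 'n set) \<rightarrow>\<^sub>E {..k}))"
    by (rule card_mono[OF _ multi_indices_subset]) (intro finite_imageI finite_PiE, auto)
  also have "\<dots> \<le> card ((UNIV :: 'n set) \<rightarrow>\<^sub>E {..k})"
    by (rule card_image_le) (intro finite_PiE, auto)
  finally show ?thesis by (simp add: card_PiE)
qed

lemma multi_indices_0: "multi_indices 0 = {0}"
  by (auto simp: multi_indices_def vec_eq_iff)

lemma sum_add_axis: "(\<Sum>i\<in>UNIV. (\<alpha> + axis j 1) $ i) = Suc (\<Sum>i\<in>UNIV. \<alpha> $ i)"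
  for \<alpha> :: "nat ^ 'n"
  by (simp add: sum.distrib axis_def)

lemma minus_axis_add_axis: "0 < \<alpha> $ j \<Longrightarrow> \<alpha> - axis j 1 + axis j 1 = \<alpha>" for \<alpha> :: "nat ^ 'n"
  by (auto simp: vec_eq_iff axis_def)

lemma multi_fact_pos: "0 < multi_fact \<alpha>"
  by (simp add: multi_fact_def prod_pos)

lemma multi_fact_add_axis: "multi_fact (\<alpha> + axis j 1) = (real (\<alpha> $ j) + 1) * multi_fact \<alpha>"
proof -
  have "(\<Prod>i\<in>UNIV - {j}. fact ((\<alpha> + axis j 1) $ i)) = (\<Prod>i\<in>UNIV - {j}. fact (\<alpha> $ i) :: real)"
    by (rule prod.cong) (auto simp: axis_def)
  then show ?thesis
    unfolding multi_fact_def by (simp add: prod.remove[of UNIV j])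
qed

text \<open>The factor \<open>\<alpha> $ j\<close> removes the indices where the truncated subtraction is junk.\<close>

lemma sum_multi_indices_lower:
  "(\<Sum>\<alpha>\<in>multi_indices (Suc k). of_real (real (\<alpha> $ j) / multi_fact \<alpha>) * h \<alpha> (\<alpha> - axis j 1))
    = (\<Sum>\<beta>\<in>multi_indices k. h (\<beta> + axis j 1) \<beta> / of_real (multi_fact \<beta>))"
  for h :: "nat ^ 'n \<Rightarrow> nat ^ 'n \<Rightarrow> complex"
proof -
  have "(\<Sum>\<alpha>\<in>multi_indices (Suc k). of_real (real (\<alpha> $ j) / multi_fact \<alpha>) * h \<alpha> (\<alpha> - axis j 1))
    = (\<Sum>\<alpha>\<in>{\<alpha> \<in> multi_indices (Suc k). 0 < \<alpha> $ j}.
        of_real (real (\<alpha> $ j) / multi_fact \<alpha>) * h \<alpha> (\<alpha> - axis j 1))"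
    by (rule sum.mono_neutral_right) (auto simp: finite_multi_indices)
  also have "\<dots> = (\<Sum>\<beta>\<in>multi_indices k. h (\<beta> + axis j 1) \<beta> / of_real (multi_fact \<beta>))"
  proof (rule sum.reindex_bij_witness[of _ "\<lambda>\<beta>. \<beta> + axis j 1" "\<lambda>\<alpha>. \<alpha> - axis j 1"])
    fix \<alpha> :: "nat ^ 'n" assume \<alpha>: "\<alpha> \<in> {\<alpha> \<in> multi_indices (Suc k). 0 < \<alpha> $ j}"
    then show inverse: "\<alpha> - axis j 1 + axis j 1 = \<alpha>" by (simp add: minus_axis_add_axis del: One_nat_def)
    show "\<alpha> - axis j 1 \<in> multi_indices k"
      using \<alpha> sum_add_axis[of "\<alpha> - axis j 1" j] by (simp add: multi_indices_def inverse del: One_nat_def)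
    \<comment> \<open>The factor \<open>\<alpha> $ j\<close> cancels against the factorial and
      leaves that of the lowered index.\<close>
    have "multi_fact \<alpha> = real (\<alpha> $ j) * multi_fact (\<alpha> - axis j 1)"
    proof -
      have "real ((\<alpha> - axis j 1) $ j) + 1 = real (\<alpha> $ j)" using \<alpha> by (simp add: axis_def)
      then show ?thesis
        using multi_fact_add_axis[of "\<alpha> - axis j 1" j] by (simp only: inverse)
    qed
    then show "h (\<alpha> - axis j 1 + axis j 1) (\<alpha> - axis j 1) / of_real (multi_fact (\<alpha> - axis j 1))
        = of_real (real (\<alpha> $ j) / multi_fact \<alpha>) * h \<alpha> (\<alpha> - axis j 1)"
      using \<alpha> by (simp add: inverse del: One_nat_def)
  next
    fix \<beta> :: "nat ^ 'n" assume "\<beta> \<in> multi_indices k"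
    moreover have "0 < (\<beta> + axis j 1) $ j" by (simp add: axis_def)
    ultimately show "\<beta> + axis j 1 \<in> {\<alpha> \<in> multi_indices (Suc k). 0 < \<alpha> $ j}"
      by (simp add: multi_indices_def sum_add_axis del: vector_add_component One_nat_def)
  qed simp
  finally show ?thesis .
qed

text \<open>Ratio test: the quotients tend to \<open>r\<close>, hence eventually stay below the
  midpoint \<open>(1 + r) / 2\<close> of \<open>r\<close> and 1.\<close>

lemma summable_polynomial_times_geometric:
  fixes r :: real
  assumes "0 < r" "r < 1"
  shows "summable (\<lambda>k. real (k + 1) ^ n * r ^ k)"
proof -
  have "(\<lambda>k. (1 + 1 / real (Suc k)) ^ n * r) \<longlonglongrightarrow> (1 + 0) ^ n * r"
    by (intro tendsto_intros LIMSEQ_Suc[OF lim_1_over_n])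
  then have "\<forall>\<^sub>F k in sequentially. (1 + 1 / real (Suc k)) ^ n * r < (1 + r) / 2"
    using assms by (intro order_tendstoD) auto
  then obtain N where N: "\<And>k. k \<ge> N \<Longrightarrow> (1 + 1 / real (Suc k)) ^ n * r < (1 + r) / 2"
    by (auto simp: eventually_sequentially)
  show ?thesis
  proof (rule summable_ratio_test[of "(1 + r) / 2" N])
    fix k assume "N \<le> k"
    have "real (Suc k + 1) = (1 + 1 / real (Suc k)) * real (k + 1)" by (simp add: field_simps)
    then have "real (Suc k + 1) ^ n * r ^ Suc k
        = ((1 + 1 / real (Suc k)) ^ n * r) * (real (k + 1) ^ n * r ^ k)"
      by (simp only: power_mult_distrib power_Suc mult_ac)
    also have "\<dots> \<le> (1 + r) / 2 * (real (k + 1) ^ n * r ^ k)"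
      using N[OF \<open>N \<le> k\<close>] assms by (intro mult_right_mono) auto
    finally show "norm (real (Suc k + 1) ^ n * r ^ Suc k) \<le> (1 + r) / 2 * norm (real (k + 1) ^ n * r ^ k)"
      using assms by (simp add: abs_mult)
  qed (use assms in auto)
qed

subsection \<open>Taylor series in the imaginary directions\<close>

definition Re_vec :: "complex ^ 'n \<Rightarrow> real ^ 'n" where
  "Re_vec z = (\<chi> i. Re (z $ i))"

definition imag_monomial :: "nat ^ 'n \<Rightarrow> complex ^ 'n \<Rightarrow> complex" where
  "imag_monomial \<alpha> z = (\<Prod>i\<in>UNIV. (\<i> * of_real (Im (z $ i))) ^ (\<alpha> $ i))"

text \<open>\<open>G\<close> stands for the family of all derivatives of a function. Keeping it
  abstract makes the derivatives of the series, which come from shifted families, series of the same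
  kind.\<close>

definition taylor_part :: "(nat ^ 'n \<Rightarrow> real ^ 'n \<Rightarrow> complex) \<Rightarrow> nat \<Rightarrow> complex ^ 'n \<Rightarrow> complex" where
  "taylor_part G k z =
    (\<Sum>\<alpha>\<in>multi_indices k. G \<alpha> (Re_vec z) / of_real (multi_fact \<alpha>) * imag_monomial \<alpha> z)"

definition taylor_sum :: "(nat ^ 'n \<Rightarrow> real ^ 'n \<Rightarrow> complex) \<Rightarrow> complex ^ 'n \<Rightarrow> complex" where
  "taylor_sum G z = (\<Sum>k. taylor_part G k z)"

text \<open>If \<open>G\<close> lists the derivatives of a smooth f, this lists those of its partial
  derivative in direction \<open>j\<close>.\<close>

definition shift :: "'n \<Rightarrow> (nat ^ 'n \<Rightarrow> real ^ 'n \<Rightarrow> complex) \<Rightarrow> nat ^ 'n \<Rightarrow> real ^ 'n \<Rightarrow> complex" where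
  "shift j G \<alpha> = G (\<alpha> + axis j 1)"

lemma Re_vec_nth [simp]: "Re_vec z $ i = Re (z $ i)"
  by (simp add: Re_vec_def)

definition derivative_system :: "(nat ^ 'n \<Rightarrow> real ^ 'n \<Rightarrow> complex) \<Rightarrow> bool" where
  "derivative_system G \<longleftrightarrow>
    (\<forall>\<alpha> x. (G \<alpha> has_derivative (\<lambda>h. \<Sum>j\<in>UNIV. (h $ j) *\<^sub>R shift j G \<alpha> x)) (at x))"

text \<open>The Taylor coefficients decay faster than every geometric rate in the degree, uniformly
  in \<open>x\<close>; this is the only consequence of the weight that convergence uses.\<close>

definition rapid_decay :: "(nat ^ 'n \<Rightarrow> real ^ 'n \<Rightarrow> complex) \<Rightarrow> bool" where
  "rapid_decay G \<longleftrightarrow>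
    (\<forall>T>0. \<exists>C. \<forall>\<alpha> x. norm (G \<alpha> x) \<le> C * multi_fact \<alpha> / T ^ (\<Sum>i\<in>UNIV. \<alpha> $ i))"

section \<open>Derivatives of the homogeneous parts\<close>

lemma has_derivative_imag_monomial:
  fixes z :: "complex ^ 'n"
  shows "(imag_monomial \<alpha> has_derivative
     (\<lambda>v. \<Sum>j\<in>UNIV. \<i> * of_real (Im (v $ j)) * (of_nat (\<alpha> $ j) * imag_monomial (\<alpha> - axis j 1) z))) (at z)"
proof -
  let ?y = "\<lambda>i z. \<i> * of_real (Im (z $ i)) :: complex"
  have coord: "bounded_linear (?y i)" for i :: 'n
    by (intro bounded_linear_const_mult bounded_linear_compose[OF bounded_linear_of_real]
        bounded_linear_compose[OF bounded_linear_Im] bounded_linear_vec_nth)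
  have "((\<lambda>z. \<Prod>i\<in>UNIV. ?y i z ^ (\<alpha> $ i)) has_derivative
      (\<lambda>v. \<Sum>j\<in>UNIV. (of_nat (\<alpha> $ j) * ?y j v * ?y j z ^ (\<alpha> $ j - 1)) *
        (\<Prod>i\<in>UNIV - {j}. ?y i z ^ (\<alpha> $ i)))) (at z)"
    by (intro has_derivative_prod has_derivative_power bounded_linear_imp_has_derivative coord)
  \<comment> \<open>Both subtractions truncate at zero, so the identity also holds when
    \<open>\<alpha> $ j = 0\<close>.\<close>
  moreover have "?y j z ^ (\<alpha> $ j - 1) * (\<Prod>i\<in>UNIV - {j}. ?y i z ^ (\<alpha> $ i)) = imag_monomial (\<alpha> - axis j 1) z" for j
  proof -
    have "(\<Prod>i\<in>UNIV - {j}. ?y i z ^ (\<alpha> $ i)) = (\<Prod>i\<in>UNIV - {j}. ?y i z ^ ((\<alpha> - axis j 1) $ i))"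
      by (rule prod.cong) (auto simp: axis_def)
    then show ?thesis
      unfolding imag_monomial_def by (subst prod.remove[of UNIV j]) (auto simp: axis_def)
  qed
  moreover have "imag_monomial \<alpha> = (\<lambda>z. \<Prod>i\<in>UNIV. ?y i z ^ (\<alpha> $ i))"
    by (simp add: fun_eq_iff imag_monomial_def)
  ultimately show ?thesis by (simp add: mult_ac)
qed

text \<open>Differentiating the coefficients shifts the family and keeps the degree. Differentiating
  the monomials lowers the degree, and after reindexing it too produces the shifted family. Real and
  imaginary directions thus have the same coefficients up to one step in \<open>k\<close>.\<close>

lemma has_derivative_taylor_part:
  assumes "derivative_system G"
  shows "(taylor_part G k has_derivative
    (\<lambda>v. \<Sum>j\<in>UNIV. of_real (Re (v $ j)) * taylor_part (shift j G) k z
       + \<i> * of_real (Im (v $ j)) * (if k = 0 then 0 else taylor_part (shift j G) (k - 1) z))) (at z)"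
proof -
  let ?G = "\<lambda>\<alpha>. G \<alpha> (Re_vec z)" and ?M = "\<lambda>\<alpha>. imag_monomial \<alpha> z"
  let ?m = "\<lambda>\<alpha>. of_real (multi_fact \<alpha>) :: complex"
  have "(Re_vec has_derivative Re_vec) (at z)"
    unfolding Re_vec_def[abs_def]
    by (intro bounded_linear_imp_has_derivative linear_conv_bounded_linear[THEN iffD1])
      (auto intro!: linearI simp: vec_eq_iff)
  then have G: "((\<lambda>z. G \<alpha> (Re_vec z)) has_derivative
      (\<lambda>v. \<Sum>j\<in>UNIV. of_real (Re (v $ j)) * shift j G \<alpha> (Re_vec z))) (at z)" for \<alpha>
    using has_derivative_compose[OF _ assms[unfolded derivative_system_def, rule_format], of Re_vec Re_vec z UNIV \<alpha>]
    by (simp add: scaleR_conv_of_real)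
  have "((\<lambda>z. \<Sum>\<alpha>\<in>multi_indices k. (G \<alpha> (Re_vec z) / ?m \<alpha>) * imag_monomial \<alpha> z) has_derivative
     (\<lambda>v. \<Sum>\<alpha>\<in>multi_indices k. (?G \<alpha> / ?m \<alpha>) *
        (\<Sum>j\<in>UNIV. \<i> * of_real (Im (v $ j)) * (of_nat (\<alpha> $ j) * imag_monomial (\<alpha> - axis j 1) z))
      + (\<Sum>j\<in>UNIV. of_real (Re (v $ j)) * shift j G \<alpha> (Re_vec z)) / ?m \<alpha> * ?M \<alpha>)) (at z)"
    by (intro has_derivative_sum has_derivative_mult has_derivative_imag_monomial
        bounded_linear.has_derivative[OF bounded_linear_divide] G)
  moreover have "(\<Sum>\<alpha>\<in>multi_indices k. (?G \<alpha> / ?m \<alpha>) *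
        (\<Sum>j\<in>UNIV. \<i> * of_real (Im (v $ j)) * (of_nat (\<alpha> $ j) * imag_monomial (\<alpha> - axis j 1) z))
      + (\<Sum>j\<in>UNIV. of_real (Re (v $ j)) * shift j G \<alpha> (Re_vec z)) / ?m \<alpha> * ?M \<alpha>)
    = (\<Sum>j\<in>UNIV. of_real (Re (v $ j)) * taylor_part (shift j G) k z
       + \<i> * of_real (Im (v $ j)) * (if k = 0 then 0 else taylor_part (shift j G) (k - 1) z))" for v
  proof -
    \<comment> \<open>The terms from the monomials are indexed anew by the lowered index; in degree
      0 the factor \<open>\<alpha> $ j\<close> is zero and nothing remains.\<close>
    have "(\<Sum>\<alpha>\<in>multi_indices k. of_real (real (\<alpha> $ j) / multi_fact \<alpha>) * (?G \<alpha> * ?M (\<alpha> - axis j 1)))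
        = (if k = 0 then 0 else taylor_part (shift j G) (k - 1) z)" for j
    proof (cases k)
      case (Suc m)
      show ?thesis
        unfolding Suc sum_multi_indices_lower[where j = j and h = "\<lambda>\<alpha> \<beta>. ?G \<alpha> * ?M \<beta>"]
        by (simp add: taylor_part_def shift_def)
    qed (simp add: multi_indices_0)
    then have "(\<Sum>j\<in>UNIV. of_real (Re (v $ j)) * taylor_part (shift j G) k z
       + \<i> * of_real (Im (v $ j)) * (if k = 0 then 0 else taylor_part (shift j G) (k - 1) z))
      = (\<Sum>j\<in>UNIV. of_real (Re (v $ j)) * taylor_part (shift j G) k z
       + \<i> * of_real (Im (v $ j)) *
         (\<Sum>\<alpha>\<in>multi_indices k. of_real (real (\<alpha> $ j) / multi_fact \<alpha>) * (?G \<alpha> * ?M (\<alpha> - axis j 1))))"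
      by simp
    also have "\<dots> = (\<Sum>j\<in>UNIV. \<Sum>\<alpha>\<in>multi_indices k.
         of_real (Re (v $ j)) * (shift j G \<alpha> (Re_vec z) / ?m \<alpha> * ?M \<alpha>)
       + \<i> * of_real (Im (v $ j)) * (of_real (real (\<alpha> $ j) / multi_fact \<alpha>) * (?G \<alpha> * ?M (\<alpha> - axis j 1))))"
      by (simp add: taylor_part_def sum_distrib_left sum.distrib)
    also have "\<dots> = (\<Sum>\<alpha>\<in>multi_indices k. \<Sum>j\<in>UNIV.
         of_real (Re (v $ j)) * (shift j G \<alpha> (Re_vec z) / ?m \<alpha> * ?M \<alpha>)
       + \<i> * of_real (Im (v $ j)) * (of_real (real (\<alpha> $ j) / multi_fact \<alpha>) * (?G \<alpha> * ?M (\<alpha> - axis j 1))))"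
      by (rule sum.swap)
    finally show ?thesis
      by (simp add: sum_distrib_left sum_distrib_right sum_divide_distrib sum.distrib mult_ac)
  qed
  moreover have "taylor_part G k = (\<lambda>z. \<Sum>\<alpha>\<in>multi_indices k. (G \<alpha> (Re_vec z) / ?m \<alpha>) * imag_monomial \<alpha> z)"
    by (simp add: fun_eq_iff taylor_part_def)
  ultimately show ?thesis by simp
qed

section \<open>Uniform convergence and termwise differentiation\<close>

lemma norm_imag_monomial: "norm (imag_monomial \<alpha> z) = (\<Prod>i\<in>UNIV. \<bar>Im (z $ i)\<bar> ^ (\<alpha> $ i))"
  by (simp add: imag_monomial_def prod_norm[symmetric] norm_power norm_mult)

lemma norm_taylor_part_le:
  fixes G :: "nat ^ 'n \<Rightarrow> real ^ 'n \<Rightarrow> complex"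
  assumes "\<And>\<alpha>. \<alpha> \<in> multi_indices k \<Longrightarrow> norm (G \<alpha> (Re_vec z)) * norm (imag_monomial \<alpha> z) \<le> B * multi_fact \<alpha>"
    and "0 \<le> B"
  shows "norm (taylor_part G k z) \<le> real (k + 1) ^ CARD('n) * B"
proof -
  have "norm (taylor_part G k z) \<le> (\<Sum>\<alpha>\<in>(multi_indices k :: (nat ^ 'n) set). B)"
    unfolding taylor_part_def
  proof (rule sum_norm_le)
    fix \<alpha> :: "nat ^ 'n" assume "\<alpha> \<in> multi_indices k"
    then show "norm (G \<alpha> (Re_vec z) / of_real (multi_fact \<alpha>) * imag_monomial \<alpha> z) \<le> B"
      using assms(1)[of \<alpha>] multi_fact_pos[of \<alpha>]
      by (simp add: norm_mult norm_divide pos_divide_le_eq)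
  qed
  also have "\<dots> \<le> real ((k + 1) ^ CARD('n)) * B"
    using card_multi_indices_le[where 'n = 'n, of k] assms(2)
    by (simp only: sum_constant) (intro mult_right_mono, auto simp only: of_nat_le_iff)
  finally show ?thesis by simp
qed

text \<open>Decay at the rate \<open>2 * R\<close> against imaginary parts of size at most
  \<open>R\<close> leaves \<open>(1 / 2) ^ k\<close> times the polynomial count of indices, a
  summable majorant for the Weierstrass test.\<close>

lemma uniform_limit_taylor_sum:
  fixes G :: "nat ^ 'n \<Rightarrow> real ^ 'n \<Rightarrow> complex"
  assumes "rapid_decay G" "0 < R"
  shows "uniform_limit (ball 0 R) (\<lambda>N z. \<Sum>k<N. taylor_part G k z) (taylor_sum G) sequentially"
proof -
  have "\<exists>C. \<forall>\<alpha> x. norm (G \<alpha> x) \<le> C * multi_fact \<alpha> / (2 * R) ^ (\<Sum>i\<in>UNIV. \<alpha> $ i)"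
    using assms(1)[unfolded rapid_decay_def, rule_format, of "2 * R"] assms(2) by simp
  then obtain C where C: "\<And>\<alpha> x. norm (G \<alpha> x) \<le> C * multi_fact \<alpha> / (2 * R) ^ (\<Sum>i\<in>UNIV. \<alpha> $ i)"
    by blast
  have "0 \<le> C" using order_trans[OF norm_ge_zero C[of 0 0]] by (simp add: multi_fact_def)
  have bound: "norm (taylor_part G k z) \<le> real (k + 1) ^ CARD('n) * (C * (1 / 2) ^ k)"
    if "z \<in> ball 0 R" for k z
  proof (rule norm_taylor_part_le)
    fix \<alpha> :: "nat ^ 'n" assume \<alpha>: "\<alpha> \<in> multi_indices k"
    have "\<bar>Im (z $ i)\<bar> \<le> R" for i
      using abs_Im_le_cmod[of "z $ i"] Finite_Cartesian_Product.norm_nth_le[of z i] that by simp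
    then have "norm (imag_monomial \<alpha> z) \<le> (\<Prod>i\<in>UNIV. R ^ (\<alpha> $ i))"
      unfolding norm_imag_monomial by (intro prod_mono) (auto intro: power_mono)
    also have "\<dots> = R ^ k" using \<alpha> by (simp add: multi_indices_def power_sum[symmetric])
    finally have "norm (G \<alpha> (Re_vec z)) * norm (imag_monomial \<alpha> z)
      \<le> (C * multi_fact \<alpha> / (2 * R) ^ k) * R ^ k"
      using C[of \<alpha> "Re_vec z"] \<alpha> by (intro mult_mono') (auto simp: multi_indices_def)
    also have "\<dots> = (C * (1 / 2) ^ k) * multi_fact \<alpha>"
      using assms(2) by (simp add: power_mult_distrib power_divide)
    finally show "norm (G \<alpha> (Re_vec z)) * norm (imag_monomial \<alpha> z) \<le> (C * (1 / 2) ^ k) * multi_fact \<alpha>" .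
  qed (use \<open>0 \<le> C\<close> in simp)
  have "summable (\<lambda>k. C * (real (k + 1) ^ CARD('n) * (1 / 2) ^ k))"
    by (intro summable_mult summable_polynomial_times_geometric) auto
  then have "summable (\<lambda>k. real (k + 1) ^ CARD('n) * (C * (1 / 2) ^ k))"
    by (simp add: mult_ac)
  with bound show ?thesis
    unfolding taylor_sum_def[abs_def] by (intro Weierstrass_m_test)
qed

lemma sums_taylor_sum:
  assumes "rapid_decay G"
  shows "(\<lambda>k. taylor_part G k z) sums taylor_sum G z"
proof -
  have "z \<in> ball 0 (norm z + 1)" by simp
  then show ?thesis
    using tendsto_uniform_limitI[OF uniform_limit_taylor_sum[OF assms, of "norm z + 1"]]
    by (simp add: sums_def add_nonneg_pos)
qed

text \<open>The shift costs a factor \<open>\<alpha> $ j + 1\<close> from the factorial. It is at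
  most 2 to the power of the degree, so decay of \<open>G\<close> at rate \<open>2 * T\<close> pays
  for it.\<close>

lemma rapid_decay_shift:
  fixes G :: "nat ^ 'n \<Rightarrow> real ^ 'n \<Rightarrow> complex"
  assumes "rapid_decay G"
  shows "rapid_decay (shift j G)"
  unfolding rapid_decay_def
proof (intro allI impI)
  fix T :: real assume "T > 0"
  then have "\<exists>C. \<forall>\<alpha> x. norm (G \<alpha> x) \<le> C * multi_fact \<alpha> / (2 * T) ^ (\<Sum>i\<in>UNIV. \<alpha> $ i)"
    using assms[unfolded rapid_decay_def, rule_format, of "2 * T"] by simp
  then obtain C where C: "\<And>\<alpha> x. norm (G \<alpha> x) \<le> C * multi_fact \<alpha> / (2 * T) ^ (\<Sum>i\<in>UNIV. \<alpha> $ i)"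
    by blast
  have "0 \<le> C" using order_trans[OF norm_ge_zero C[of 0 0]] by (simp add: multi_fact_def)
  show "\<exists>C. \<forall>\<alpha> x. norm (shift j G \<alpha> x) \<le> C * multi_fact \<alpha> / T ^ (\<Sum>i\<in>UNIV. \<alpha> $ i)"
  proof (intro exI allI)
    fix \<alpha> :: "nat ^ 'n" and x
    let ?k = "\<Sum>i\<in>UNIV. \<alpha> $ i"
    have "\<alpha> $ j \<le> ?k" by (rule member_le_sum) auto
    moreover have "?k + 1 \<le> 2 ^ ?k" using Suc_leI[OF less_exp] by simp
    ultimately have "real (\<alpha> $ j) + 1 \<le> real (2 ^ ?k)"
      using of_nat_mono[of "\<alpha> $ j + 1" "2 ^ ?k", where 'a = real] by linarith
    then have "C * ((real (\<alpha> $ j) + 1) * multi_fact \<alpha>) / (2 * T) ^ Suc ?k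
        \<le> C * (2 ^ ?k * multi_fact \<alpha>) / (2 * T) ^ Suc ?k"
      using \<open>0 \<le> C\<close> \<open>T > 0\<close> multi_fact_pos[of \<alpha>]
      by (intro divide_right_mono mult_left_mono mult_right_mono) auto
    also have "\<dots> = C / (2 * T) * multi_fact \<alpha> / T ^ ?k"
      using \<open>T > 0\<close> by (simp add: power_mult_distrib field_simps)
    finally show "norm (shift j G \<alpha> x) \<le> C / (2 * T) * multi_fact \<alpha> / T ^ ?k"
      using C[of "\<alpha> + axis j 1" x] unfolding shift_def multi_fact_add_axis sum_add_axis by linarith
  qed
qed

text \<open>The differentiated series in the imaginary directions lags one degree behind the one in
  the real directions. In the limit the lag disappears, so \<open>Re (v $ j)\<close> and
  \<open>\<i> * Im (v $ j)\<close> receive the same coefficient and combine to \<open>v $ j\<close>: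
  the Cauchy-Riemann equations.\<close>

lemma has_derivative_taylor_sum:
  fixes G :: "nat ^ 'n \<Rightarrow> real ^ 'n \<Rightarrow> complex"
  assumes deriv: "derivative_system G" and decay: "rapid_decay G"
  shows "(taylor_sum G has_derivative (\<lambda>v. \<Sum>j\<in>UNIV. v $ j * taylor_sum (shift j G) z)) (at z)"
proof -
  define S where "S = ball (0 :: complex ^ 'n) (norm z + 1)"
  have "z \<in> S" "convex S" "open S" by (auto simp: S_def)
  let ?P = "\<lambda>j N w. \<Sum>k<N. taylor_part (shift j G) k w"
  let ?W = "\<lambda>j w. taylor_sum (shift j G) w"
  let ?f' = "\<lambda>k w v. \<Sum>j\<in>UNIV. of_real (Re (v $ j)) * taylor_part (shift j G) k w
       + \<i> * of_real (Im (v $ j)) * (if k = 0 then 0 else taylor_part (shift j G) (k - 1) w)"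
  have "\<exists>g. \<forall>w\<in>S. (\<lambda>k. taylor_part G k w) sums g w \<and>
    (g has_derivative (\<lambda>v. \<Sum>j\<in>UNIV. v $ j * ?W j w)) (at w within S)"
  proof (rule has_derivative_series[OF \<open>convex S\<close> _ _ \<open>z \<in> S\<close> sums_taylor_sum[OF decay]])
    show "(taylor_part G k has_derivative ?f' k w) (at w within S)" for k w
      by (rule has_derivative_at_withinI[OF has_derivative_taylor_part[OF deriv]])
    fix e :: real assume "e > 0"
    \<comment> \<open>Each coordinate contributes two errors, one from the real and one from the
      imaginary part of \<open>v $ j\<close>.\<close>
    define \<epsilon> where "\<epsilon> = e / (2 * CARD('n))"
    have "\<epsilon> > 0" using \<open>e > 0\<close> by (simp add: \<epsilon>_def)
    have "\<forall>\<^sub>F N in sequentially. \<forall>w\<in>S. dist (?P j N w) (?W j w) < \<epsilon>" for j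
      unfolding S_def
      by (rule uniform_limitD[OF uniform_limit_taylor_sum[OF rapid_decay_shift[OF decay]] \<open>\<epsilon> > 0\<close>])
        (simp add: add_nonneg_pos)
    then have "\<forall>\<^sub>F N in sequentially. \<forall>j\<in>UNIV. \<forall>w\<in>S. dist (?P j N w) (?W j w) < \<epsilon>"
      by (intro eventually_ball_finite) auto
    then obtain N0 where N0: "\<And>N j w. N \<ge> N0 \<Longrightarrow> w \<in> S \<Longrightarrow> norm (?P j N w - ?W j w) < \<epsilon>"
      by (auto simp: eventually_sequentially dist_norm)
    have "norm ((\<Sum>k<N. ?f' k w v) - (\<Sum>j\<in>UNIV. v $ j * ?W j w)) \<le> e * norm v"
      if N: "N \<ge> Suc N0" and w: "w \<in> S" for N w v
    proof -
      \<comment> \<open>The lagging partial sum has \<open>M = N - 1\<close> terms, so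
        \<open>N\<close> must exceed \<open>N0\<close> by one for both errors to be small.\<close>
      obtain M where M: "N = Suc M" "M \<ge> N0" using N by (cases N) auto
      have "(\<Sum>k<N. if k = 0 then 0 else taylor_part (shift j G) (k - 1) w) = ?P j M w" for j
        unfolding M(1) by (subst sum.lessThan_Suc_shift) simp
      then have "(\<Sum>k<N. ?f' k w v) = (\<Sum>j\<in>UNIV. of_real (Re (v $ j)) * ?P j N w + \<i> * of_real (Im (v $ j)) * ?P j M w)"
        by (subst sum.swap) (simp add: sum.distrib sum_distrib_left[symmetric])
      moreover have "v $ j = of_real (Re (v $ j)) + \<i> * of_real (Im (v $ j))" for j
        by (rule complex_eq)
      then have "(\<Sum>j\<in>UNIV. v $ j * ?W j w) =
          (\<Sum>j\<in>UNIV. (of_real (Re (v $ j)) + \<i> * of_real (Im (v $ j))) * ?W j w)"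
        by simp
      ultimately have "(\<Sum>k<N. ?f' k w v) - (\<Sum>j\<in>UNIV. v $ j * ?W j w)
          = (\<Sum>j\<in>UNIV. of_real (Re (v $ j)) * (?P j N w - ?W j w)
               + \<i> * of_real (Im (v $ j)) * (?P j M w - ?W j w))"
        by (simp only: sum_subtractf[symmetric] ring_distribs) (simp add: algebra_simps)
      also have "norm \<dots> \<le> (\<Sum>j\<in>(UNIV :: 'n set). norm v * \<epsilon> + norm v * \<epsilon>)"
      proof (intro sum_norm_le norm_triangle_le add_mono)
        fix j
        show "norm (of_real (Re (v $ j)) * (?P j N w - ?W j w)) \<le> norm v * \<epsilon>"
          using abs_Re_le_cmod[of "v $ j"] Finite_Cartesian_Product.norm_nth_le[of v j] N0[of N w j] N w
          unfolding norm_mult by (intro mult_mono) auto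
        show "norm (\<i> * of_real (Im (v $ j)) * (?P j M w - ?W j w)) \<le> norm v * \<epsilon>"
          using abs_Im_le_cmod[of "v $ j"] Finite_Cartesian_Product.norm_nth_le[of v j] N0[of M w j] M w
          unfolding norm_mult by (intro mult_mono) auto
      qed
      also have "\<dots> = e * norm v" by (simp add: \<epsilon>_def)
      finally show ?thesis .
    qed
    then show "\<forall>\<^sub>F N in sequentially. \<forall>w\<in>S. \<forall>v.
        norm ((\<Sum>k<N. ?f' k w v) - (\<Sum>j\<in>UNIV. v $ j * ?W j w)) \<le> e * norm v"
      unfolding eventually_sequentially by blast
  qed
  then obtain g where g: "\<And>w. w \<in> S \<Longrightarrow> (\<lambda>k. taylor_part G k w) sums g w"
    "\<And>w. w \<in> S \<Longrightarrow> (g has_derivative (\<lambda>v. \<Sum>j\<in>UNIV. v $ j * ?W j w)) (at w within S)"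
    by blast
  have "(g has_derivative (\<lambda>v. \<Sum>j\<in>UNIV. v $ j * ?W j z)) (at z)"
    using g(2)[OF \<open>z \<in> S\<close>] at_within_open[OF \<open>z \<in> S\<close> \<open>open S\<close>] by simp
  \<comment> \<open>\<open>g\<close> is known only through its series on \<open>S\<close>;
    uniqueness of sums identifies it there with \<open>taylor_sum G\<close>.\<close>
  then show ?thesis
    by (rule has_derivative_transform_within_open[OF _ \<open>open S\<close> \<open>z \<in> S\<close>])
      (use g(1) sums_taylor_sum[OF decay] sums_unique2 in blast)
qed

lemma entire_taylor_sum:
  assumes "derivative_system G" "rapid_decay G"
  shows "entire (taylor_sum G)"
  unfolding entire_def
  using has_derivative_taylor_sum[OF assms]
  by (fastforce simp: sum_distrib_left mult.assoc)

text \<open>At a real point every monomial of positive degree has a zero factor, so the series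
  reduces to its term of degree 0.\<close>

lemma taylor_sum_real_point: "taylor_sum G (real_point x) = G 0 x"
proof -
  have "imag_monomial \<alpha> (real_point x) = 0" if "\<alpha> \<in> multi_indices k" "k > 0" for \<alpha> k
  proof -
    obtain i where "\<alpha> $ i \<noteq> 0"
      using \<open>\<alpha> \<in> multi_indices k\<close> \<open>k > 0\<close> by (fastforce simp: multi_indices_def)
    then show ?thesis by (auto simp: imag_monomial_def real_point_def prod_zero_iff)
  qed
  then have "taylor_part G k (real_point x) = 0" if "k > 0" for k
    using that by (simp add: taylor_part_def)
  then have "taylor_sum G (real_point x) = (\<Sum>k\<in>{0}. taylor_part G k (real_point x))"
    unfolding taylor_sum_def by (intro suminf_finite) auto
  also have "\<dots> = G 0 x"
    by (simp add: taylor_part_def multi_indices_0 multi_fact_def imag_monomial_def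
        Re_vec_def real_point_def)
  finally show ?thesis .
qed

subsection \<open>Uniqueness of the extension\<close>

text \<open>Restriction to the complex line \<open>x + wy\<close> through \<open>z = x + iy\<close> reduces the claim to one variable.\<close>

lemma entire_eqI:
  fixes F H :: "complex ^ 'n \<Rightarrow> complex"
  assumes "entire F" "entire H" and eq: "\<And>x. F (real_point x) = H (real_point x)"
  shows "F = H"
proof
  fix z :: "complex ^ 'n"
  define y :: "complex ^ 'n" where "y = (\<chi> i. of_real (Im (z $ i)))"
  define line :: "complex \<Rightarrow> complex ^ 'n" where "line = (\<lambda>w. real_point (Re_vec z) + w *s y)"
  have line_deriv: "(line has_derivative (\<lambda>w. w *s y)) (at w)" for w
  proof -
    have "bounded_linear (\<lambda>w. w *s y)"
      by (intro linear_conv_bounded_linear[THEN iffD1] linearI) (auto simp: vec_eq_iff algebra_simps)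
    then show ?thesis
      unfolding line_def
      using has_derivative_add[OF has_derivative_const bounded_linear_imp_has_derivative]
      by (metis (no_types, lifting) ext add_0)
  qed
  \<comment> \<open>Complex linearity of the derivative \<open>L\<close> turns
    \<open>L (h *s y)\<close> into \<open>h * L y\<close>, so \<open>L y\<close> is the complex
    derivative along the line.\<close>
  have holo: "(\<lambda>w. K (line w)) holomorphic_on UNIV" if "entire K" for K
  proof -
    have "\<exists>D. ((\<lambda>w. K (line w)) has_field_derivative D) (at w)" for w
    proof -
      obtain L where L: "(K has_derivative L) (at (line w))" "\<And>c v. L (c *s v) = c * L v"
        using \<open>entire K\<close> unfolding entire_def by blast
      have "((\<lambda>w. K (line w)) has_derivative (\<lambda>h. L (h *s y))) (at w)"
        using has_derivative_compose[OF line_deriv L(1)] by simp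
      then show ?thesis
        unfolding has_field_derivative_def L(2) by (auto simp: mult.commute[of _ "L y"])
    qed
    then show ?thesis by (simp add: holomorphic_on_def field_differentiable_def)
  qed
  have "line \<i> = z" by (simp add: line_def y_def real_point_def Re_vec_def vec_eq_iff complex_eq_iff)
  have line_real: "line (of_real t) = real_point (\<chi> i. Re (z $ i) + t * Im (z $ i))" for t
    by (simp add: line_def y_def real_point_def Re_vec_def vec_eq_iff)
  have "F (line \<i>) - H (line \<i>) = 0"
  \<comment> \<open>Real parameters give real points, where both functions agree, and the real axis
    accumulates at 0. The identity theorem carries this to the parameter \<i>, which gives
    \<open>z\<close>.\<close>
  proof (rule analytic_continuation[where f = "\<lambda>w. F (line w) - H (line w)" and S = UNIV and U = "\<real>" and \<xi> = 0])
    show "(\<lambda>w. F (line w) - H (line w)) holomorphic_on UNIV"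
      by (intro holomorphic_on_diff holo assms)
    show "0 islimpt (\<real> :: complex set)"
      unfolding islimpt_approachable
    proof (intro allI impI)
      fix e :: real assume "e > 0"
      then show "\<exists>x'\<in>\<real>. x' \<noteq> 0 \<and> dist x' (0 :: complex) < e"
        by (intro bexI[of _ "of_real (e / 2)"]) (auto simp: dist_norm)
    qed
    show "F (line w) - H (line w) = 0" if "w \<in> \<real>" for w
      using that by (auto simp: Reals_def line_real eq)
  qed auto
  then show "F z = H z" by (simp add: \<open>line \<i> = z\<close>)
qed

subsection \<open>Bounds from the Young--Fenchel conjugate\<close>

text \<open>The componentwise logarithm of \<open>r\<close> is one competitor in the supremum
  defining the conjugate. Finiteness of the conjugate makes the passage from \<open>ereal\<close> to
  real values faithful.\<close>

lemma exp_minus_psi_star_le: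
  fixes \<phi> :: "real ^ 'n \<Rightarrow> real"
  assumes "\<phi> \<in> class_A" and pos: "\<And>i. 0 < r $ i"
  shows "exp (- real_of_ereal (psi_star \<phi> (multi_real \<alpha>))) * (\<Prod>i\<in>UNIV. r $ i ^ (\<alpha> $ i)) \<le> exp (\<phi> r)"
proof -
  define t :: "real ^ 'n" where "t = (\<chi> i. ln (r $ i))"
  have "psi \<phi> t = \<phi> r" using pos by (simp add: psi_def t_def)
  have "ereal (multi_real \<alpha> \<bullet> t - psi \<phi> t) \<le> psi_star \<phi> (multi_real \<alpha>)"
    unfolding psi_star_def young_fenchel_def by (rule SUP_upper2[of t]) auto
  moreover have "\<bar>psi_star \<phi> (multi_real \<alpha>)\<bar> \<noteq> \<infinity>"
    by (rule psi_star_finite[OF assms(1)]) (simp add: multi_real_def)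
  ultimately have "multi_real \<alpha> \<bullet> t - \<phi> r \<le> real_of_ereal (psi_star \<phi> (multi_real \<alpha>))"
    using \<open>psi \<phi> t = \<phi> r\<close> by (cases "psi_star \<phi> (multi_real \<alpha>)") auto
  moreover have "(\<Prod>i\<in>UNIV. r $ i ^ (\<alpha> $ i)) = exp (multi_real \<alpha> \<bullet> t)"
    using pos by (simp add: inner_vec_def multi_real_def t_def exp_sum exp_of_nat_mult)
  ultimately show ?thesis by (simp flip: exp_add)
qed

lemma D_multi_bound:
  fixes f :: "real ^ 'n \<Rightarrow> complex"
  assumes "f \<in> smooth_E_weight h"
  shows "\<exists>C\<ge>0. \<forall>x \<alpha>. (1 + norm x) ^ m * norm (D_multi \<alpha> f x)
    \<le> C * (multi_fact \<alpha> * exp (- real_of_ereal (h (multi_real \<alpha>))))"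
proof -
  let ?v = "\<lambda>x \<alpha>. (1 + norm x) ^ m * norm (D_multi \<alpha> f x) /
      (multi_fact \<alpha> * exp (- real_of_ereal (h (multi_real \<alpha>))))"
  have "q_norm h m f < \<infinity>"
    using assms by (auto simp: smooth_E_weight_def smooth_E_m_def)
  moreover have upper: "ereal (?v x \<alpha>) \<le> q_norm h m f" for x \<alpha>
    unfolding q_norm_def by (rule SUP_upper2[of "(x, \<alpha>)"]) auto
  \<comment> \<open>One real value below the supremum excludes minus infinity.\<close>
  ultimately obtain C where C: "q_norm h m f = ereal C"
    using upper[of 0 0] by (cases "q_norm h m f") auto
  have "?v x \<alpha> \<le> C" for x \<alpha> using upper[of x \<alpha>] by (simp add: C)
  then have "?v x \<alpha> \<le> max C 0" for x \<alpha> by (simp add: le_max_iff_disj)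
  then show ?thesis
    by (intro exI[of _ "max C 0"]) (simp add: pos_divide_le_eq multi_fact_pos)
qed

section \<open>The derivatives of f as a rapidly decaying system\<close>

lemma D_multi_0: "D_multi 0 f = f" for f :: "real ^ 'n \<Rightarrow> complex"
proof -
  have "foldr (\<lambda>i g. (partial_deriv i ^^ ((0 :: nat ^ 'n) $ i)) g) is f = f" for "is"
    by (induction "is") auto
  then show ?thesis unfolding D_multi_def .
qed

lemma derivative_system_D_multi:
  assumes "C_infinity f"
  shows "derivative_system (\<lambda>\<alpha>. D_multi \<alpha> f)"
  unfolding derivative_system_def shift_def partial_deriv_D_multi[OF assms, symmetric]
  by (intro allI has_derivative_partial_deriv C_infinity_D_multi assms)

text \<open>The conjugate bound is used at the constant vector with entries \<open>T\<close>, where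
  the monomial is \<open>T\<close> to the power of the degree; \<open>exp (\<phi> ?r)\<close> goes
  into the constant.\<close>

lemma rapid_decay_D_multi:
  fixes f :: "real ^ 'n \<Rightarrow> complex"
  assumes "\<phi> \<in> class_A" and f: "f \<in> smooth_E_weight (psi_star \<phi>)"
  shows "rapid_decay (\<lambda>\<alpha>. D_multi \<alpha> f)"
  unfolding rapid_decay_def
proof (intro allI impI)
  fix T :: real assume "0 < T"
  obtain C where "0 \<le> C" and C: "\<And>x \<alpha>. norm (D_multi \<alpha> f x)
    \<le> C * (multi_fact \<alpha> * exp (- real_of_ereal (psi_star \<phi> (multi_real \<alpha>))))"
    using D_multi_bound[OF f, of 0] by auto
  let ?r = "\<chi> i. T"
  show "\<exists>C. \<forall>\<alpha> x. norm (D_multi \<alpha> f x) \<le> C * multi_fact \<alpha> / T ^ (\<Sum>i\<in>UNIV. \<alpha> $ i)"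
  proof (intro exI allI)
    fix \<alpha> :: "nat ^ 'n" and x
    have "exp (- real_of_ereal (psi_star \<phi> (multi_real \<alpha>))) * T ^ (\<Sum>i\<in>UNIV. \<alpha> $ i) \<le> exp (\<phi> ?r)"
      using exp_minus_psi_star_le[OF assms(1), of ?r \<alpha>] \<open>0 < T\<close> by (simp add: power_sum)
    then have "exp (- real_of_ereal (psi_star \<phi> (multi_real \<alpha>))) \<le> exp (\<phi> ?r) / T ^ (\<Sum>i\<in>UNIV. \<alpha> $ i)"
      using \<open>0 < T\<close> by (simp add: pos_le_divide_eq)
    then have "C * (multi_fact \<alpha> * exp (- real_of_ereal (psi_star \<phi> (multi_real \<alpha>))))
      \<le> C * (multi_fact \<alpha> * (exp (\<phi> ?r) / T ^ (\<Sum>i\<in>UNIV. \<alpha> $ i)))"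
      using \<open>0 \<le> C\<close> multi_fact_pos[of \<alpha>] by (intro mult_left_mono) auto
    with C[of \<alpha> x] show "norm (D_multi \<alpha> f x) \<le> C * exp (\<phi> ?r) * multi_fact \<alpha> / T ^ (\<Sum>i\<in>UNIV. \<alpha> $ i)"
      by (simp add: mult_ac)
  qed
qed

lemma norm_le_Re_Im: "norm z \<le> norm (Re_vec z) + norm (\<chi> i. \<bar>Im (z $ i)\<bar>)" for z :: "complex ^ 'n"
proof -
  have "norm z \<le> L2_set (\<lambda>i. \<bar>Re (z $ i)\<bar> + \<bar>Im (z $ i)\<bar>) UNIV"
    unfolding norm_vec_def by (intro L2_set_mono cmod_le norm_ge_zero)
  also have "\<dots> \<le> L2_set (\<lambda>i. \<bar>Re (z $ i)\<bar>) UNIV + L2_set (\<lambda>i. \<bar>Im (z $ i)\<bar>) UNIV"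
    by (rule L2_set_triangle_ineq)
  finally show ?thesis by (simp add: norm_vec_def)
qed

text \<open>The weight in the real part is carried by the derivatives of \<open>f\<close>, with the
  same power \<open>k\<close>. In the conjugate bound at \<open>r\<close>, the factor \<sigma>
  leaves \<open>(1 / \<sigma>) ^ l\<close> in degree \<open>l\<close>, so the sum over degrees costs
  a constant independent of \<open>z\<close>.\<close>

lemma taylor_sum_bound:
  fixes f :: "real ^ 'n \<Rightarrow> complex" and \<sigma> :: real
  assumes \<phi>: "\<phi> \<in> class_A" and f: "f \<in> smooth_E_weight (psi_star \<phi>)" and "1 < \<sigma>"
  shows "\<exists>C\<ge>0. \<forall>z. (1 + norm (Re_vec z)) ^ k * norm (taylor_sum (\<lambda>\<alpha>. D_multi \<alpha> f) z)
    \<le> C * exp (\<phi> (\<sigma> *\<^sub>R (\<chi> i. \<bar>Im (z $ i)\<bar> + 1)))"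
proof -
  let ?G = "\<lambda>\<alpha>. D_multi \<alpha> f"
  obtain C where "0 \<le> C" and C: "\<And>x \<alpha>. (1 + norm x) ^ k * norm (D_multi \<alpha> f x)
    \<le> C * (multi_fact \<alpha> * exp (- real_of_ereal (psi_star \<phi> (multi_real \<alpha>))))"
    using D_multi_bound[OF f, of k] by auto
  define b where "b = (\<lambda>l. real (l + 1) ^ CARD('n) * (1 / \<sigma>) ^ l)"
  have "summable b"
    unfolding b_def using \<open>1 < \<sigma>\<close> by (intro summable_polynomial_times_geometric) auto
  have "(1 + norm (Re_vec z)) ^ k * norm (taylor_sum ?G z)
    \<le> (C * suminf b) * exp (\<phi> (\<sigma> *\<^sub>R (\<chi> i. \<bar>Im (z $ i)\<bar> + 1)))" for z
  proof -
    define r :: "real ^ 'n" where "r = \<sigma> *\<^sub>R (\<chi> i. \<bar>Im (z $ i)\<bar> + 1)"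
    define w where "w = (1 + norm (Re_vec z)) ^ k"
    have "0 < w" by (simp add: w_def add_pos_nonneg)
    have "norm (taylor_part ?G l z) \<le> real (l + 1) ^ CARD('n) * (C * exp (\<phi> r) / w * (1 / \<sigma>) ^ l)" for l
    proof (rule norm_taylor_part_le)
      fix \<alpha> :: "nat ^ 'n" assume \<alpha>: "\<alpha> \<in> multi_indices l"
      then have l: "l = (\<Sum>i\<in>UNIV. \<alpha> $ i)" by (simp add: multi_indices_def)
      let ?e = "exp (- real_of_ereal (psi_star \<phi> (multi_real \<alpha>)))"
      have "\<sigma> ^ l * norm (imag_monomial \<alpha> z) \<le> \<sigma> ^ l * (\<Prod>i\<in>UNIV. (\<bar>Im (z $ i)\<bar> + 1) ^ (\<alpha> $ i))"
        unfolding norm_imag_monomial using \<open>1 < \<sigma>\<close>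
        by (intro mult_left_mono prod_mono) (auto intro: power_mono)
      also have "\<dots> = (\<Prod>i\<in>UNIV. r $ i ^ (\<alpha> $ i))"
        by (simp add: l r_def power_mult_distrib prod.distrib power_sum)
      finally have "?e * (\<sigma> ^ l * norm (imag_monomial \<alpha> z)) \<le> ?e * (\<Prod>i\<in>UNIV. r $ i ^ (\<alpha> $ i))"
        by (intro mult_left_mono) auto
      also have "\<dots> \<le> exp (\<phi> r)"
        using \<open>1 < \<sigma>\<close> by (intro exp_minus_psi_star_le[OF \<phi>]) (simp add: r_def add_nonneg_pos)
      finally have "C * multi_fact \<alpha> * (?e * (\<sigma> ^ l * norm (imag_monomial \<alpha> z)))
          \<le> C * multi_fact \<alpha> * exp (\<phi> r)"
        using \<open>0 \<le> C\<close> multi_fact_pos[of \<alpha>] by (intro mult_left_mono) auto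
      moreover have "w * norm (?G \<alpha> (Re_vec z)) * (\<sigma> ^ l * norm (imag_monomial \<alpha> z))
          \<le> C * (multi_fact \<alpha> * ?e) * (\<sigma> ^ l * norm (imag_monomial \<alpha> z))"
        unfolding w_def using C \<open>1 < \<sigma>\<close> by (intro mult_right_mono) auto
      ultimately have "(norm (?G \<alpha> (Re_vec z)) * norm (imag_monomial \<alpha> z)) * (w * \<sigma> ^ l)
          \<le> C * exp (\<phi> r) * multi_fact \<alpha>"
        by (simp add: mult_ac)
      then have "norm (?G \<alpha> (Re_vec z)) * norm (imag_monomial \<alpha> z)
          \<le> C * exp (\<phi> r) * multi_fact \<alpha> / (w * \<sigma> ^ l)"
        using \<open>0 < w\<close> \<open>1 < \<sigma>\<close> by (subst pos_le_divide_eq) auto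
      then show "norm (?G \<alpha> (Re_vec z)) * norm (imag_monomial \<alpha> z)
          \<le> C * exp (\<phi> r) / w * (1 / \<sigma>) ^ l * multi_fact \<alpha>"
        by (simp add: power_divide mult_ac)
    qed (use \<open>0 \<le> C\<close> \<open>0 < w\<close> \<open>1 < \<sigma>\<close> in simp)
    then have part: "norm (taylor_part ?G l z) \<le> C * exp (\<phi> r) / w * b l" for l
      by (simp add: b_def mult_ac)
    have "norm (taylor_sum ?G z) \<le> (\<Sum>l. C * exp (\<phi> r) / w * b l)"
      unfolding taylor_sum_def using part \<open>summable b\<close> by (intro norm_suminf_le summable_mult)
    also have "\<dots> = C * exp (\<phi> r) / w * suminf b" by (rule suminf_mult[OF \<open>summable b\<close>])
    finally have "w * norm (taylor_sum ?G z) \<le> w * (C * exp (\<phi> r) / w * suminf b)"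
      using \<open>0 < w\<close> by (intro mult_left_mono) auto
    also have "\<dots> = (C * suminf b) * exp (\<phi> r)" using \<open>0 < w\<close> by simp
    finally show ?thesis unfolding w_def r_def .
  qed
  moreover have "0 \<le> suminf b"
    using \<open>1 < \<sigma>\<close> by (intro suminf_nonneg \<open>summable b\<close>) (simp add: b_def)
  ultimately show ?thesis using \<open>0 \<le> C\<close> by (intro exI[of _ "C * suminf b"]) auto
qed

section \<open>Extension theorem: existence, uniqueness and growth\<close>

theorem theorem2:
  fixes \<phi> :: "nat \<Rightarrow> real ^ 'n \<Rightarrow> real"
  assumes in_A: "\<forall>m\<ge>1. \<phi> m \<in> class_A"
    and i: "\<forall>m\<ge>1. \<forall>A>0. \<exists>C>0. \<forall>x. \<phi> m x + A * ln (1 + norm x) \<le> \<phi> (Suc m) x + C"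
    and ii: "\<forall>m\<ge>1. \<exists>\<sigma>>1. \<exists>\<gamma>>0. \<forall>x. \<phi> m (\<sigma> *\<^sub>R x) \<le> \<phi> (Suc m) x + \<gamma>"
    and iii: "\<forall>m\<ge>1. \<exists>K>0. \<forall>x \<xi>. (\<forall>j. 0 \<le> x $ j) \<and> (\<forall>j. 0 \<le> \<xi> $ j \<and> \<xi> $ j \<le> 1)
                \<longrightarrow> \<phi> m (x + \<xi>) \<le> \<phi> (Suc m) x + K"
  shows "\<forall>f \<in> smooth_E_family (\<lambda>\<nu>. psi_star (\<phi> \<nu>)).
           (\<exists>!F. entire F \<and> (\<forall>x. F (real_point x) = f x))
           \<and> (\<forall>F. entire F \<and> (\<forall>x. F (real_point x) = f x) \<longrightarrow> F \<in> E_family \<phi>)"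
proof
  fix f assume "f \<in> smooth_E_family (\<lambda>\<nu>. psi_star (\<phi> \<nu>))"
  then obtain \<nu> where \<nu>: "\<nu> \<ge> 1" and f: "f \<in> smooth_E_weight (psi_star (\<phi> \<nu>))"
    by (auto simp: smooth_E_family_def)
  have A: "\<phi> \<nu> \<in> class_A" using in_A \<nu> by blast
  have "C_infinity f" using f by (auto simp: smooth_E_weight_def smooth_E_m_def)
  define F where "F = taylor_sum (\<lambda>\<alpha>. D_multi \<alpha> f)"
  have "entire F"
    unfolding F_def
    by (intro entire_taylor_sum derivative_system_D_multi rapid_decay_D_multi[OF A] f \<open>C_infinity f\<close>)
  have extends: "F (real_point x) = f x" for x
    by (simp add: F_def taylor_sum_real_point D_multi_0)
  \<comment> \<open>Every entire extension is \<open>F\<close>, so the growth bound has to be shown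
    for \<open>F\<close> alone.\<close>
  have unique: "H = F" if "entire H" "\<forall>x. H (real_point x) = f x" for H
    using that extends by (intro entire_eqI \<open>entire F\<close>) auto

  obtain \<sigma> \<gamma> where "1 < \<sigma>" and \<gamma>: "\<And>x. \<phi> \<nu> (\<sigma> *\<^sub>R x) \<le> \<phi> (Suc \<nu>) x + \<gamma>"
    using ii \<nu> by blast
  obtain K where K: "\<And>x \<xi>. (\<forall>j. 0 \<le> x $ j) \<and> (\<forall>j. 0 \<le> \<xi> $ j \<and> \<xi> $ j \<le> 1)
      \<Longrightarrow> \<phi> (Suc \<nu>) (x + \<xi>) \<le> \<phi> (Suc (Suc \<nu>)) x + K"
    using iii[rule_format, of "Suc \<nu>"] by auto
  \<comment> \<open>Conditions (ii), (iii) and (i) each raise the index by one. The index \<mu> is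
    fixed before \<open>k\<close>, so one weight serves all powers.\<close>
  define \<mu> where "\<mu> = Suc (Suc (Suc \<nu>))"
  have "p_norm (\<phi> \<mu>) k F < \<infinity>" for k
  proof -
    obtain C where "0 \<le> C" and C: "\<And>z. (1 + norm (Re_vec z)) ^ k * norm (F z)
        \<le> C * exp (\<phi> \<nu> (\<sigma> *\<^sub>R (\<chi> i. \<bar>Im (z $ i)\<bar> + 1)))"
      using taylor_sum_bound[OF A f \<open>1 < \<sigma>\<close>, of k] unfolding F_def by blast
    \<comment> \<open>The exponent is \<open>real k + 1\<close> because (i) asks for a positive one
      and \<open>k\<close> may be 0.\<close>
    obtain L where L: "\<And>x. \<phi> (Suc (Suc \<nu>)) x + (real k + 1) * ln (1 + norm x) \<le> \<phi> \<mu> x + L"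
      using i[rule_format, of "Suc (Suc \<nu>)" "real k + 1"] by (auto simp: \<mu>_def)
    have "norm (F z) * (1 + norm z) ^ k / exp (\<phi> \<mu> (\<chi> i. \<bar>Im (z $ i)\<bar>)) \<le> C * exp (\<gamma> + K + L)" for z
    proof -
      define y :: "real ^ 'n" where "y = (\<chi> i. \<bar>Im (z $ i)\<bar>)"
      have "(\<chi> i. \<bar>Im (z $ i)\<bar> + 1) = y + (\<chi> i. 1)" by (simp add: y_def vec_eq_iff)
      \<comment> \<open>First (ii) removes \<sigma> at the shifted point, then (iii) removes the
        shift by the vector of ones.\<close>
      then have "\<phi> \<nu> (\<sigma> *\<^sub>R (\<chi> i. \<bar>Im (z $ i)\<bar> + 1)) \<le> \<phi> (Suc (Suc \<nu>)) y + K + \<gamma>"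
        using \<gamma>[of "y + (\<chi> i. 1)"] K[of y "\<chi> i. 1"] by (simp add: y_def)
      moreover have "real k * ln (1 + norm y) \<le> (real k + 1) * ln (1 + norm y)"
        by (intro mult_right_mono) auto
      ultimately have "\<phi> \<nu> (\<sigma> *\<^sub>R (\<chi> i. \<bar>Im (z $ i)\<bar> + 1)) + real k * ln (1 + norm y)
          \<le> \<phi> \<mu> y + (\<gamma> + K + L)"
        using L[of y] by linarith
      then have "exp (\<phi> \<nu> (\<sigma> *\<^sub>R (\<chi> i. \<bar>Im (z $ i)\<bar> + 1))) * exp (real k * ln (1 + norm y))
          \<le> exp (\<phi> \<mu> y) * exp (\<gamma> + K + L)"
        by (simp flip: exp_add)
      moreover have "exp (real k * ln (1 + norm y)) = (1 + norm y) ^ k"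
        by (simp add: exp_of_nat_mult add_pos_nonneg)
      ultimately have weight: "exp (\<phi> \<nu> (\<sigma> *\<^sub>R (\<chi> i. \<bar>Im (z $ i)\<bar> + 1))) * (1 + norm y) ^ k
          \<le> exp (\<phi> \<mu> y) * exp (\<gamma> + K + L)" by simp
      \<comment> \<open>The weight splits into a factor in the real part, absorbed by
        \<open>taylor_sum_bound\<close>, and one in the imaginary part, absorbed by (i).\<close>
      have "1 + norm z \<le> 1 + norm (Re_vec z) + norm y"
        using norm_le_Re_Im[of z] by (simp add: y_def)
      also have "\<dots> \<le> (1 + norm (Re_vec z)) * (1 + norm y)" by (simp add: algebra_simps)
      finally have "(1 + norm z) ^ k \<le> ((1 + norm (Re_vec z)) * (1 + norm y)) ^ k"
        by (rule power_mono) simp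
      then have "norm (F z) * (1 + norm z) ^ k
          \<le> norm (F z) * ((1 + norm (Re_vec z)) * (1 + norm y)) ^ k"
        by (rule mult_left_mono) simp
      also have "\<dots> = ((1 + norm (Re_vec z)) ^ k * norm (F z)) * (1 + norm y) ^ k"
        by (simp only: power_mult_distrib mult_ac)
      also have "\<dots> \<le> (C * exp (\<phi> \<nu> (\<sigma> *\<^sub>R (\<chi> i. \<bar>Im (z $ i)\<bar> + 1)))) * (1 + norm y) ^ k"
        by (intro mult_right_mono C) simp
      also have "\<dots> \<le> C * (exp (\<phi> \<mu> y) * exp (\<gamma> + K + L))"
        unfolding mult.assoc by (intro mult_left_mono weight \<open>0 \<le> C\<close>)
      finally show ?thesis by (simp add: pos_divide_le_eq mult_ac flip: y_def)
    qed
    then have "p_norm (\<phi> \<mu>) k F \<le> ereal (C * exp (\<gamma> + K + L))"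
      unfolding p_norm_def by (intro SUP_least) simp
    then show ?thesis by (rule le_less_trans) simp
  qed
  then have "F \<in> E_weight (\<phi> \<mu>)"
    using \<open>entire F\<close> by (simp add: E_weight_def E_k_def)
  then have "F \<in> E_family \<phi>"
    unfolding E_family_def by (rule UN_I[rotated]) (simp add: \<mu>_def)
  then show "(\<exists>!F. entire F \<and> (\<forall>x. F (real_point x) = f x))
      \<and> (\<forall>F. entire F \<and> (\<forall>x. F (real_point x) = f x) \<longrightarrow> F \<in> E_family \<phi>)"
    using unique extends \<open>entire F\<close> by blast
qed

end
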